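(* Let $n\ge5$. Every permutation $w\in S_n$ whose Robinson–Schensted recording tableau $Q(w)$ equals $\widehat Q$ has steady-state time $n-3$.
   Context: For $n\ge5$, $\widehat Q$ is the standard tableau of shape $(n-3,2,1)$ (English notation) whose first row is $1,2,5,6,\dots,n-1$, second row is $3,4$, and third row is $n$. Box-ball system (BBS): boxes are arranged in a row extending infinitely to the right, each box holds at most one ball, balls are labeled $1,\dots,n$. A permutation $w=w_1\cdots w_n$ gives the time-$0$ configuration with ball $w_i$ in the $i$-th of $n$ consecutive boxes. A BBS move moves ball $1$ to the nearest empty box to its right, then ball $2$, ..., then ball $n$; the state at time $t$ is obtained after $t$ moves. An increasing run is a maximal block of balls in consecutive boxes with labels increasing left to right; a soliton is an increasing run preserved by all subsequent BBS moves (its balls stay consecutive and in order, and the runs keep their relative order). A configuration is in steady state if all its increasing runs are solitons. The steady-state time of $w$ is the least $t\ge0$ such that the state at time $t$ is in steady state. *)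

theory Defs
  imports "HOL-Combinatorics.Multiset_Permutations"
begin

text \<open>
  Permutations in one-line notation are elements of
  \<^term>\<open>permutations_of_set {1..n}\<close>. Tableaux are lists of rows, the top row first.
\<close>

section \<open>The Robinson--Schensted recording tableau\<close>

type_synonym tableau = "nat list list"

text \<open>The second component of the result is the bumped entry, if any.\<close>

fun row_insert :: "nat \<Rightarrow> nat list \<Rightarrow> nat list \<times> nat option" where
  "row_insert x [] = ([x], None)"
| "row_insert x (y # ys) =
     (if x < y then (x # ys, Some y)
      else (case row_insert x ys of (ys', b) \<Rightarrow> (y # ys', b)))"

fun rs_insert :: "nat \<Rightarrow> tableau \<Rightarrow> tableau" where
  "rs_insert x [] = [[x]]"
| "rs_insert x (r # rs) =
     (case row_insert x r of
        (r', None) \<Rightarrow> r' # rs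
      | (r', Some y) \<Rightarrow> r' # rs_insert y rs)"

text \<open>The index (from 0) of the row that becomes longer when \<open>x\<close> is inserted.\<close>

fun new_cell_row :: "nat \<Rightarrow> tableau \<Rightarrow> nat" where
  "new_cell_row x [] = 0"
| "new_cell_row x (r # rs) =
     (case row_insert x r of
        (r', None) \<Rightarrow> 0
      | (r', Some y) \<Rightarrow> Suc (new_cell_row y rs))"

text \<open>
  Append \<open>k\<close> to the row with index \<open>i\<close>. In the RS algorithm the index never exceeds the number
  of rows, so the last equation is only used to open a new row.
\<close>

fun add_cell :: "nat \<Rightarrow> nat \<Rightarrow> tableau \<Rightarrow> tableau" where
  "add_cell k 0 (r # rs) = (r @ [k]) # rs"
| "add_cell k (Suc i) (r # rs) = r # add_cell k i rs"
| "add_cell k i [] = [[k]]"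

definition rs_step :: "nat \<times> nat \<Rightarrow> tableau \<times> tableau \<Rightarrow> tableau \<times> tableau" where
  "rs_step = (\<lambda>(k, x) (P, Q). (rs_insert x P, add_cell k (new_cell_row x P) Q))"

definition robinson_schensted :: "nat list \<Rightarrow> tableau \<times> tableau" where
  "robinson_schensted w = fold rs_step (zip [1..<length w + 1] w) ([], [])"

definition recording_tableau :: "nat list \<Rightarrow> tableau" where
  "recording_tableau w = snd (robinson_schensted w)"

definition Q_hat :: "nat \<Rightarrow> tableau" where
  "Q_hat n = [[1, 2] @ [5..<n], [3, 4], [n]]"


section \<open>The box-ball system\<close>

text \<open>
  Boxes are numbered \<open>0, 1, 2, \<dots>\<close> from left to right; a configuration assigns to each
  box the label of the ball it contains, if any.
\<close>

type_synonym config = "nat \<Rightarrow> nat option"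

definition initial_config :: "nat list \<Rightarrow> config" where
  "initial_config w = (\<lambda>i. if i < length w then Some (w ! i) else None)"

definition box_of :: "config \<Rightarrow> nat \<Rightarrow> nat" where
  "box_of c b = (THE i. c i = Some b)"

definition move_ball :: "nat \<Rightarrow> config \<Rightarrow> config" where
  "move_ball b c =
     (let i = box_of c b; j = (LEAST j. i < j \<and> c j = None)
      in c(i := None, j := Some b))"

definition bbs_move :: "nat \<Rightarrow> config \<Rightarrow> config" where
  "bbs_move n c = fold move_ball [1..<n + 1] c"

definition bbs_state :: "nat list \<Rightarrow> nat \<Rightarrow> config" where
  "bbs_state w t = (bbs_move (length w) ^^ t) (initial_config w)"

text \<open>
  A run is given by the list of its labels. The last two conjuncts are maximality:
  the run extends neither to the left nor to the right.
\<close>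

definition increasing_run :: "config \<Rightarrow> nat list \<Rightarrow> bool" where
  "increasing_run c r \<longleftrightarrow>
     r \<noteq> [] \<and> sorted_wrt (<) r \<and>
     (\<exists>i. (\<forall>k < length r. c (i + k) = Some (r ! k)) \<and>
          (\<forall>b. i > 0 \<and> c (i - 1) = Some b \<longrightarrow> \<not> b < hd r) \<and>
          (\<forall>b. c (i + length r) = Some b \<longrightarrow> \<not> last r < b))"

text \<open>
  A soliton remains an increasing run, with the same balls, after any number of moves, and its
  left-to-right order relative to every other run that is still present does not change.
\<close>

definition soliton :: "nat \<Rightarrow> config \<Rightarrow> nat list \<Rightarrow> bool" where
  "soliton n c r \<longleftrightarrow>
     increasing_run c r \<and>
     (\<forall>s. let c' = (bbs_move n ^^ s) c in
        increasing_run c' r \<and>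
        (\<forall>r'. increasing_run c r' \<and> increasing_run c' r' \<longrightarrow>
           (box_of c' (hd r) < box_of c' (hd r') \<longleftrightarrow> box_of c (hd r) < box_of c (hd r'))))"

definition steady_state :: "nat \<Rightarrow> config \<Rightarrow> bool" where
  "steady_state n c \<longleftrightarrow> (\<forall>r. increasing_run c r \<longrightarrow> soliton n c r)"

definition steady_state_time :: "nat list \<Rightarrow> nat" where
  "steady_state_time w = (LEAST t. steady_state (length w) (bbs_state w t))"

end

theory Submission
  imports Defs
begin

text \<open>
  A move can be computed by a carrier that traverses the boxes from left to right: at a ball it
  performs a row insertion into its load and leaves the bumped ball behind, at an empty box it
  unloads its smallest ball.

  The tableau \<^term>\<open>Q_hat n\<close> forces \<open>w = a b R x\<close> with \<open>R\<close> increasing, the first two entries of \<open>R\<close>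
  smaller than \<open>a\<close> and \<open>b\<close> respectively, and \<open>x\<close> bumping some \<open>c < b\<close> from \<open>R\<close>, which becomes \<open>L\<close>.
  After one move the increasing blocks \<open>a b\<close>, \<open>c\<close> and \<open>L\<close> have \<open>n - 5\<close> and \<open>0\<close> empty boxes between
  them and move with speeds \<open>2\<close>, \<open>1\<close> and \<open>n - 3\<close>. The pair catches up with \<open>c\<close> at time \<open>n - 4\<close>, and
  the next move exchanges a ball between them: a single ball \<open>d\<close> is left behind a new pair \<open>e f\<close>.
  From then on the blocks are ordered by speed and never interact again.
\<close>

section \<open>The carrier description of a move\<close>

fun carrier_read :: "nat option \<Rightarrow> nat list \<Rightarrow> nat list \<times> nat option" where
  "carrier_read (Some b) C = row_insert b C"
| "carrier_read None [] = ([], None)"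
| "carrier_read None (y # C) = (C, Some y)"

text \<open>Balls heavier than \<open>k\<close> have not moved yet and act as fixed obstacles: the
  carrier passes them with its load unchanged.\<close>

definition carrier_read_upto :: "nat \<Rightarrow> nat option \<Rightarrow> nat list \<Rightarrow> nat list \<times> nat option" where
  "carrier_read_upto k x C = (if \<exists>b. x = Some b \<and> k < b then (C, x) else carrier_read x C)"

primrec carrier :: "nat \<Rightarrow> config \<Rightarrow> nat \<Rightarrow> nat list" where
  "carrier k c 0 = []"
| "carrier k c (Suc i) = fst (carrier_read_upto k (c i) (carrier k c i))"

text \<open>What the carrier leaves behind; by iterating \<open>move_ball_sweep\<close> this becomes
  the state after balls 1 to \<open>k\<close> have moved.\<close>

definition sweep :: "nat \<Rightarrow> config \<Rightarrow> config" where
  "sweep k c i = snd (carrier_read_upto k (c i) (carrier k c i))"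

section \<open>Row insertion and the load of the carrier\<close>

lemma row_insert_set: "set (fst (row_insert x r)) \<subseteq> insert x (set r)"
  by (induction r) (auto split: prod.splits)

lemma row_insert_bumped_in: "row_insert x r = (r', Some y) \<Longrightarrow> y \<in> set r"
  by (induction r arbitrary: r') (auto split: prod.splits if_splits)

lemma row_insert_append_if_ge:
  "\<forall>y\<in>set A. y \<le> x \<Longrightarrow> row_insert x (A @ B) = (A @ fst (row_insert x B), snd (row_insert x B))"
  by (induction A) (auto split: prod.splits)

lemma row_insert_snoc:
  "row_insert x (C @ [y]) =
    (case row_insert x C of
       (C', Some z) \<Rightarrow> (C' @ [y], Some z)
     | (C', None) \<Rightarrow> if x < y then (C', Some y) else (C @ [y, x], None))"
  by (induction C) (auto split: prod.splits option.splits)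

lemma row_insert_None:
  "row_insert x r = (r', None) \<Longrightarrow> r' = r @ [x] \<and> (\<forall>y\<in>set r. y \<le> x)"
  by (induction r arbitrary: r') (auto split: prod.splits if_splits)

lemma carrier_read_set:
  assumes "carrier_read x C = (C', y)"
  shows "set C' \<subseteq> set C \<union> set_option x" "set_option y \<subseteq> set C"
proof -
  show "set C' \<subseteq> set C \<union> set_option x"
    using assms row_insert_set by (cases "(x, C)" rule: carrier_read.cases) (auto, force)
  show "set_option y \<subseteq> set C"
    using assms by (cases "(x, C)" rule: carrier_read.cases; cases y) (auto dest: row_insert_bumped_in)
qed

lemma carrier_bound: "set (carrier k c i) \<subseteq> {..k}"
proof (induction i)
  case (Suc i)
  obtain C' y where r: "carrier_read (c i) (carrier k c i) = (C', y)" by fastforce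
  show ?case using Suc carrier_read_set(1)[OF r] r
    by (cases "c i") (auto simp: carrier_read_upto_def not_less)
qed simp

text \<open>The load consists of labels up to \<open>k\<close>, so a heavier label is never dropped,
  and one that is already there stays.\<close>

lemma sweep_eq_larger:
  assumes "k < b"
  shows "sweep k c i = Some b \<longleftrightarrow> c i = Some b"
proof -
  obtain C' y where r: "carrier_read (c i) (carrier k c i) = (C', y)" by fastforce
  show ?thesis using carrier_bound[of k c i] carrier_read_set[OF r] r assms
    by (auto simp: sweep_def carrier_read_upto_def)
qed

lemma carrier_read_upto_Suc:
  assumes "x \<noteq> Some (Suc k)"
  shows "carrier_read_upto (Suc k) x C = carrier_read_upto k x C"
  using assms by (auto simp: carrier_read_upto_def)

lemma carrier_read_upto_load:
  assumes "set C \<subseteq> {..k}"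
  shows "carrier_read_upto (Suc k) (Some (Suc k)) C = (C @ [Suc k], None)"
  using row_insert_append_if_ge[of C "Suc k" "[]"] assms
  by (force simp: carrier_read_upto_def)

text \<open>A ball that is heavier than everything else in the carrier stays at its end until the first
  box that would otherwise become empty.\<close>

lemma carrier_read_upto_snoc:
  assumes "x \<noteq> Some (Suc k)" "carrier_read_upto k x C = (C', y)"
  shows "carrier_read_upto (Suc k) x (C @ [Suc k]) =
    (if y = None then (C', Some (Suc k)) else (C' @ [Suc k], y))"
  using assms
  by (cases "(x, C)" rule: carrier_read.cases)
     (auto simp: carrier_read_upto_def row_insert_snoc split: if_splits option.splits prod.splits)

text \<open>Past the last ball the carrier unloads one ball per box until it is empty. This makes
  the target box of the next ball exist.\<close>

lemma sweep_eventually_None: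
  assumes "\<And>i. N \<le> i \<Longrightarrow> c i = None"
  shows "\<exists>q>p. sweep k c q = None"
proof -
  \<comment> \<open>The subtraction is truncated: an empty carrier stays empty.\<close>
  have *: "length (carrier k c (N + j)) = length (carrier k c N) - j" for j
  proof (induction j)
    case (Suc j)
    then show ?case using assms
      by (cases "carrier k c (N + j)") (auto simp: carrier_read_upto_def)
  qed simp
  define q where "q = N + (length (carrier k c N) + Suc p)"
  have "carrier k c q = []" using *[of "length (carrier k c N) + Suc p"] by (simp add: q_def)
  then have "sweep k c q = None" using assms by (simp add: sweep_def carrier_read_upto_def q_def)
  then show ?thesis by (intro exI[of _ q]) (simp add: q_def)
qed

text \<open>The carriers for \<open>k\<close> and \<open>Suc k\<close> agree up to box
  \<open>p\<close>. Between \<open>p\<close> and \<open>q\<close> the second one holds ball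
  \<open>Suc k\<close> in addition, at its end; it drops it at \<open>q\<close>, the first box that
  would otherwise be empty, and from there on they agree again.\<close>

lemma move_ball_sweep:
  assumes supp: "\<And>i. N \<le> i \<Longrightarrow> c i = None"
    and p: "c p = Some (Suc k)" and uniq: "\<And>i. c i = Some (Suc k) \<Longrightarrow> i = p"
  shows "move_ball (Suc k) (sweep k c) = sweep (Suc k) c"
proof -
  define q where "q = (LEAST q. p < q \<and> sweep k c q = None)"
  have q: "p < q" "sweep k c q = None"
    using LeastI_ex[of "\<lambda>q. p < q \<and> sweep k c q = None"]
      sweep_eventually_None[of N c p k, OF supp] by (auto simp: q_def)
  have q_min: "sweep k c i \<noteq> None" if "p < i" "i < q" for i
    using that not_less_Least[of i "\<lambda>q. p < q \<and> sweep k c q = None"] by (auto simp: q_def)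
  have other: "c i \<noteq> Some (Suc k)" if "i \<noteq> p" for i using uniq that by blast
  have before: "carrier (Suc k) c i = carrier k c i" if "i \<le> p" for i
    using that by (induction i) (auto simp: carrier_read_upto_Suc other)
  have at_p: "carrier_read_upto (Suc k) (c p) (carrier (Suc k) c p) = (carrier k c p @ [Suc k], None)"
    using p carrier_bound[of k c p] by (simp add: before carrier_read_upto_load)
  have at_p': "carrier_read_upto k (c p) (carrier k c p) = (carrier k c p, Some (Suc k))"
    using p by (simp add: carrier_read_upto_def)
  have between: "carrier (Suc k) c (Suc p + j) = carrier k c (Suc p + j) @ [Suc k]" if "Suc p + j \<le> q" for j
    using that
  proof (induction j)
    case 0
    then show ?case using at_p at_p' by simp
  next
    case (Suc j)
    then show ?case
      using carrier_read_upto_snoc[OF other[of "Suc p + j"] surjective_pairing] q_min[of "Suc p + j"]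
      by (auto simp: sweep_def)
  qed
  have betw: "carrier (Suc k) c i = carrier k c i @ [Suc k]" if "p < i" "i \<le> q" for i
    using between[of "i - Suc p"] that by simp
  have at_q: "carrier_read_upto (Suc k) (c q) (carrier (Suc k) c q) = (carrier k c (Suc q), Some (Suc k))"
    using carrier_read_upto_snoc[OF other[of q] surjective_pairing] q betw[of q]
    by (simp add: sweep_def)
  have after: "carrier (Suc k) c (Suc q + j) = carrier k c (Suc q + j)" for j
    using q(1) by (induction j) (auto simp: at_q carrier_read_upto_Suc other)
  have aft: "carrier (Suc k) c i = carrier k c i" if "q < i" for i
    using after[of "i - Suc q"] that by simp
  have box: "box_of (sweep k c) (Suc k) = p"
    unfolding box_of_def by (rule the_equality) (auto simp: sweep_eq_larger p intro: uniq)
  have "sweep (Suc k) c i = ((sweep k c)(p := None, q := Some (Suc k))) i" for i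
  proof -
    consider "i < p" | "i = p" | "p < i" "i < q" | "i = q" | "q < i" by linarith
    then show ?thesis
    proof cases
      case 1
      then show ?thesis using q by (simp add: sweep_def before carrier_read_upto_Suc other)
    next
      case 2
      then show ?thesis using q at_p by (simp add: sweep_def)
    next
      case 3
      then show ?thesis
        using carrier_read_upto_snoc[OF other[of i] surjective_pairing] q_min[of i]
        by (simp add: sweep_def betw)
    next
      case 4
      then show ?thesis using q at_q by (simp add: sweep_def)
    next
      case 5
      then show ?thesis using q by (simp add: sweep_def aft carrier_read_upto_Suc other)
    qed
  qed
  then show ?thesis
    by (simp add: move_ball_def box q_def[symmetric] Let_def fun_eq_iff)
qed

lemma sweep_0: "(\<And>i. c i \<noteq> Some 0) \<Longrightarrow> sweep 0 c = c"
proof (rule ext)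
  fix i assume nz: "\<And>i. c i \<noteq> Some 0"
  have C: "carrier 0 c i = []" for i
  proof (induction i)
    case (Suc i)
    then show ?case using nz[of i] by (cases "c i") (auto simp: carrier_read_upto_def)
  qed simp
  show "sweep 0 c i = c i" using nz[of i] C by (cases "c i") (auto simp: carrier_read_upto_def sweep_def)
qed

text \<open>Induction on the number of balls already moved, each step being
  \<open>move_ball_sweep\<close>.\<close>

lemma bbs_move_eq_sweep:
  assumes "\<And>i. N \<le> i \<Longrightarrow> c i = None" and "\<And>i. c i \<noteq> Some 0"
    and "\<And>b. b \<in> {1..n} \<Longrightarrow> \<exists>!i. c i = Some b"
  shows "bbs_move n c = sweep n c"
proof -
  have "fold move_ball [1..<k + 1] c = sweep k c" if "k \<le> n" for k
    using that
  proof (induction k)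
    case (Suc k)
    then obtain p where p: "c p = Some (Suc k)" "\<And>i. c i = Some (Suc k) \<Longrightarrow> i = p"
      using assms(3)[of "Suc k"] by (auto elim!: ex1E)
    show ?case using move_ball_sweep[where c = c and N = N, OF assms(1) p] Suc by simp
  qed (simp add: sweep_0 assms)
  then show ?thesis by (simp add: bbs_move_def)
qed

section \<open>Finite configurations as lists of boxes\<close>

definition cfg :: "nat option list \<Rightarrow> config" where
  "cfg xs i = (if i < length xs then xs ! i else None)"

definition balls :: "nat option list \<Rightarrow> nat list" where
  "balls xs = map the (filter (\<lambda>x. x \<noteq> None) xs)"

fun carrier_run :: "nat list \<Rightarrow> nat option list \<Rightarrow> nat list \<times> nat option list" where
  "carrier_run C [] = (C, [])"
| "carrier_run C (x # xs) =
     (case carrier_read x C of (C', y) \<Rightarrow> case carrier_run C' xs of (C'', ys) \<Rightarrow> (C'', y # ys))"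

lemma carrier_run_append:
  "carrier_run C (xs @ ys) =
    (case carrier_run C xs of (C', us) \<Rightarrow> case carrier_run C' ys of (C'', vs) \<Rightarrow> (C'', us @ vs))"
  by (induction xs arbitrary: C) (auto split: prod.splits)

lemma length_carrier_run: "carrier_run C xs = (C', ys) \<Longrightarrow> length ys = length xs"
  by (induction xs arbitrary: C ys) (auto split: prod.splits)

lemma balls_simps [simp]:
  "balls [] = []" "balls (Some b # xs) = b # balls xs" "balls (None # xs) = balls xs"
  "balls (xs @ ys) = balls xs @ balls ys" "balls (map Some bs) = bs" "balls (replicate k None) = []"
  by (simp_all add: balls_def filter_map o_def)

lemma set_balls: "b \<in> set (balls xs) \<longleftrightarrow> Some b \<in> set xs"
  by (force simp: balls_def image_iff)

lemma cfg_append_None: "cfg (xs @ replicate j None) = cfg xs"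
  by (auto simp: cfg_def nth_append)

lemma cfg_unique:
  "distinct (balls xs) \<Longrightarrow> cfg xs i = Some b \<Longrightarrow> cfg xs j = Some b \<Longrightarrow> i = j"
proof (induction xs arbitrary: i j)
  case (Cons x xs)
  have *: "b \<in> set (balls xs)" if "cfg xs k = Some b" for k
    using that by (auto simp: cfg_def set_balls split: if_splits) (metis nth_mem)
  show ?case using Cons *[of "i - 1"] *[of "j - 1"] Cons.IH[of "i - 1" "j - 1"]
    by (cases i; cases j; cases x) (auto simp: cfg_def split: if_splits)
qed (simp add: cfg_def)

text \<open>Start box \<open>s\<close> and load \<open>C\<close> are arbitrary so that the induction
  can advance by one box.\<close>

lemma sweep_carrier_run:
  assumes "carrier_run C xs = (C', ys)" "carrier n c s = C" "\<And>b. Some b \<in> set xs \<Longrightarrow> b \<le> n"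
    "\<And>i. i < length xs \<Longrightarrow> c (s + i) = xs ! i"
  shows "carrier n c (s + length xs) = C' \<and> (\<forall>i<length xs. sweep n c (s + i) = ys ! i)"
  using assms
proof (induction xs arbitrary: C s ys)
  case (Cons x xs)
  obtain C1 y where r: "carrier_read x C = (C1, y)" by fastforce
  obtain zs where zs: "carrier_run C1 xs = (C', zs)" "ys = y # zs"
    using Cons.prems(1) r by (auto split: prod.splits)
  have x: "c s = x" using Cons.prems(4)[of 0] by simp
  have u: "carrier_read_upto n (c s) (carrier n c s) = (C1, y)"
    using Cons.prems(2) Cons.prems(3)[of "the x"] r x by (auto simp: carrier_read_upto_def)
  have "carrier n c (Suc s + length xs) = C' \<and> (\<forall>i<length xs. sweep n c (Suc s + i) = zs ! i)"
    using u Cons.prems(3) Cons.prems(4)[of "Suc i" for i] by (intro Cons.IH[OF zs(1)]) auto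
  then show ?case using u by (auto simp: zs(2) sweep_def nth_Cons' gr0_conv_Suc)
qed simp

text \<open>Reduces a move to a list computation. The \<open>j\<close> empty boxes leave room to
  unload, and the final empty load certifies that no ball ends up further right.\<close>

lemma bbs_move_cfg:
  assumes perm: "balls xs \<in> permutations_of_set {1..n}"
    and run: "carrier_run [] (xs @ replicate j None) = ([], ys)"
  shows "bbs_move n (cfg xs) = cfg ys"
proof -
  let ?c = "cfg xs" and ?zs = "xs @ replicate j None"
  have set: "Some b \<in> set xs \<longleftrightarrow> b \<in> {1..n}" for b
    using perm by (simp add: permutations_of_set_def set_balls[symmetric])
  have dist: "distinct (balls xs)" using perm by (simp add: permutations_of_set_def)
  have ex: "\<exists>i. ?c i = Some b" if "b \<in> {1..n}" for b
    using that set[of b] unfolding in_set_conv_nth by (metis cfg_def)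
  have cfg_in: "?c i \<noteq> Some 0" for i
    using set[of 0] by (auto simp: cfg_def) (metis nth_mem)
  have len: "length ys = length ?zs" using run length_carrier_run by blast
  have sw: "carrier n ?c (length ?zs) = []" "\<And>i. i < length ?zs \<Longrightarrow> sweep n ?c i = ys ! i"
    using sweep_carrier_run[OF run, of n ?c 0] set
    by (auto simp: cfg_append_None[of xs j, symmetric] cfg_def)
  have tail: "carrier n ?c (length ?zs + k) = []" for k
    using sw(1) by (induction k) (auto simp: cfg_def carrier_read_upto_def)
  have "sweep n ?c i = cfg ys i" for i
  proof (cases "i < length ?zs")
    case False
    then show ?thesis using len tail[of "i - length ?zs"]
      by (simp add: cfg_def sweep_def carrier_read_upto_def)
  qed (use sw len in \<open>simp add: cfg_def\<close>)
  moreover have "bbs_move n ?c = sweep n ?c"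
    by (rule bbs_move_eq_sweep[of "length xs"])
      (use ex cfg_unique[OF dist] cfg_in in \<open>blast | simp add: cfg_def\<close>)+
  ultimately show ?thesis by (simp add: fun_eq_iff)
qed

text \<open>Normalises stretches of empty boxes, so that two descriptions of a state differ only in
  arithmetic.\<close>

lemma replicate_merge:
  "replicate i x @ replicate j x = replicate (i + j) x"
  "replicate i x @ replicate j x @ ys = replicate (i + j) x @ ys"
  "replicate i x @ x # replicate j x = replicate (Suc (i + j)) x"
  "replicate i x @ x # ys = replicate (Suc i) x @ ys"
  "x # replicate j x = replicate (Suc j) x"
  "x # replicate j x @ ys = replicate (Suc j) x @ ys"
  by (simp_all add: replicate_add replicate_app_Cons_same)

section \<open>The carrier crossing gaps and blocks of balls\<close>

lemma carrier_run_appendI: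
  "carrier_run C xs = (C', us) \<Longrightarrow> carrier_run C' ys = (C'', vs) \<Longrightarrow>
    carrier_run C (xs @ ys) = (C'', us @ vs)"
  by (simp add: carrier_run_append)

lemma carrier_run_cong:
  "carrier_run C xs = (C', ys) \<Longrightarrow> xs = xs' \<Longrightarrow> ys = ys' \<Longrightarrow> carrier_run C xs' = (C', ys')"
  by simp

lemma carrier_run_empty: "carrier_run [] (replicate k None) = ([], replicate k None)"
  by (induction k) auto

lemma carrier_run_load:
  "sorted_wrt (<) (A @ B) \<Longrightarrow> carrier_run A (map Some B) = (A @ B, replicate (length B) None)"
proof (induction B arbitrary: A)
  case (Cons b B)
  have "row_insert b A = (A @ [b], None)"
    using row_insert_append_if_ge[of A b "[]"] Cons.prems by (auto simp: sorted_wrt_append less_imp_le)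
  with Cons.IH[of "A @ [b]"] Cons.prems show ?case by simp
qed simp

lemma carrier_run_unload:
  "carrier_run C (replicate (length C + k) None) = ([], map Some C @ replicate k None)"
  by (induction C) (auto simp: carrier_run_empty)

text \<open>Ball \<open>c\<close> lands in the first box in either case: it is dropped there if the
  box is empty, and bumped by \<open>l\<close> if there is no gap.\<close>

lemma carrier_run_exchange1:
  assumes "l < c" "sorted_wrt (<) (l # ls)"
  shows "carrier_run [c] (replicate h None @ map Some (l # ls)) =
    (l # ls, Some c # replicate (h + length ls) None)"
proof (cases h)
  case 0
  then show ?thesis using assms carrier_run_load[of "[l]" ls] by simp
next
  case (Suc k)
  have "carrier_run [] (replicate k None @ map Some (l # ls)) =
      (l # ls, replicate k None @ replicate (length (l # ls)) None)"
    using carrier_run_load[of "[]" "l # ls"] assms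
    by (intro carrier_run_appendI[OF carrier_run_empty]) simp
  then show ?thesis using Suc by (simp add: replicate_merge(1-4))
qed

text \<open>Without a gap \<open>l1\<close> bumps \<open>e\<close> and \<open>l2\<close> bumps
  \<open>f\<close>. Otherwise \<open>e\<close> drops into the first empty box, and the one-ball
  exchange remains for \<open>f\<close>.\<close>

lemma carrier_run_exchange2:
  assumes "l1 < e" "l2 < f" "e < f" "sorted_wrt (<) (l1 # l2 # ls)"
  shows "carrier_run [e, f] (replicate h None @ map Some (l1 # l2 # ls)) =
    (l1 # l2 # ls, Some e # Some f # replicate (h + length ls) None)"
proof (cases h)
  case 0
  then show ?thesis using assms carrier_run_load[of "[l1, l2]" ls] by auto
next
  case (Suc k)
  then show ?thesis using carrier_run_exchange1[of l1 f "l2 # ls" k] assms by auto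
qed

text \<open>If only one box is free, \<open>a\<close> takes it and \<open>c\<close> bumps
  \<open>b\<close>; otherwise both are dropped before \<open>c\<close> is reached. Either way the
  gap behind \<open>c\<close> shrinks by one.\<close>

lemma carrier_run_pair:
  assumes "a < b" "c < b"
  shows "carrier_run [a, b] (replicate (Suc g) None @ [Some c]) = ([c], Some a # Some b # replicate g None)"
proof (cases g)
  case (Suc k)
  then show ?thesis using carrier_run_appendI[OF carrier_run_empty[of k], of "[Some c]" "[c]" "[None]"]
    by (simp add: replicate_append_same)
qed (use assms in auto)

text \<open>The converse situation: the pair is ahead of the slower single ball, and the gap grows
  by one.\<close>

lemma carrier_run_single:
  assumes "e < d" "e < f"
  shows "carrier_run [d] (replicate s None @ [Some e, Some f]) = ([e, f], Some d # replicate (Suc s) None)"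
  using carrier_run_exchange1[of e d "[f]" s] assms by simp

section \<open>The evolution after the first move\<close>

text \<open>Below \<open>N\<close> stands for \<open>n - 5\<close>. The \<open>s\<close>-th early state is reached after \<open>s + 1\<close> moves (for
  \<open>s \<le> N\<close>), the \<open>s\<close>-th late state after \<open>N + 2 + s\<close> moves.\<close>

definition early_state :: "nat \<Rightarrow> nat \<Rightarrow> nat \<Rightarrow> nat \<Rightarrow> nat list \<Rightarrow> nat \<Rightarrow> nat option list" where
  "early_state N a b c L s =
    replicate (2 * s + 2) None @ [Some a, Some b] @ replicate (N - s) None @ [Some c] @
    replicate (s * (N + 1)) None @ map Some L"

definition late_state :: "nat \<Rightarrow> nat \<Rightarrow> nat \<Rightarrow> nat \<Rightarrow> nat list \<Rightarrow> nat \<Rightarrow> nat option list" where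
  "late_state N d e f L s =
    replicate (2 * N + 4 + s) None @ [Some d] @ replicate s None @ [Some e, Some f] @
    replicate (N * (N + 2 + s)) None @ map Some L"

lemma balls_early_state: "balls (early_state N a b c L s) = [a, b, c] @ L"
  by (simp add: early_state_def)

lemma balls_late_state: "balls (late_state N d e f L s) = [d, e, f] @ L"
  by (simp add: late_state_def)

text \<open>The pair advances by 2, \<open>c\<close> by 1 and \<open>L\<close> by its length
  \<open>N + 2\<close>, so the first gap shrinks by one and the second one grows by
  \<open>N + 1\<close>. The bound \<open>s < N\<close> says that the first gap is still
  open.\<close>

lemma move_early_state:
  assumes "s < N" and L: "sorted_wrt (<) L" "length L = N + 2" "hd L < c"
    and "a < b" "c < b" and perm: "[a, b, c] @ L \<in> permutations_of_set {1..n}"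
  shows "bbs_move n (cfg (early_state N a b c L s)) = cfg (early_state N a b c L (Suc s))"
proof (rule bbs_move_cfg)
  show "balls (early_state N a b c L s) \<in> permutations_of_set {1..n}"
    unfolding balls_early_state by (rule perm)
  obtain l ls where l: "L = l # ls" using L by (cases L) auto
  obtain g where g: "N - s = Suc g" "N - Suc s = g" using assms(1) by (metis Suc_diff_Suc)
  have 1: "carrier_run [] [Some a, Some b] = ([a, b], [None, None])" using assms(5) by simp
  have 2: "carrier_run [c] (replicate (s * (N + 1)) None @ map Some L) =
      (L, Some c # replicate (s * (N + 1) + (N + 1)) None)"
    using carrier_run_exchange1[of l c ls "s * (N + 1)"] L l by simp
  \<comment> \<open>\<open>L\<close> has \<open>N + 2\<close> balls, so this many further boxes
    empty the carrier.\<close>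
  have 3: "carrier_run L (replicate (N + 2) None) = ([], map Some L)"
    using carrier_run_unload[of L 0] L by simp
  show "carrier_run [] (early_state N a b c L s @ replicate (N + 2) None) =
    ([], early_state N a b c L (Suc s))"
    apply (rule carrier_run_cong[OF carrier_run_appendI[OF carrier_run_empty[of "2 * s + 2"]
        carrier_run_appendI[OF 1 carrier_run_appendI[OF carrier_run_pair[of a b c g]
        carrier_run_appendI[OF 2 3]]]]])
    using assms(5,6) apply simp_all[2]
    subgoal by (simp add: early_state_def g)
    apply (simp only: early_state_def g append.simps replicate_merge mult_Suc add_Suc_right)
    by (simp add: algebra_simps del: replicate_Suc)
qed

text \<open>With the first gap closed, \<open>c\<close> is row-inserted into the load
  \<open>[a, b]\<close>: the bumped ball is \<open>d\<close>, and the row that results is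
  \<open>[e, f]\<close>.\<close>

lemma collide_early_state:
  assumes L: "sorted_wrt (<) (l1 # l2 # ls)" "length ls = N" and "a < b" "c < b" "l1 < e" "l2 < f"
    and def: "(d, e, f) = (if c < a then (a, c, b) else (b, a, c))"
    and perm: "[a, b, c] @ l1 # l2 # ls \<in> permutations_of_set {1..n}"
  shows "bbs_move n (cfg (early_state N a b c (l1 # l2 # ls) N)) = cfg (late_state N d e f (l1 # l2 # ls) 0)"
proof (rule bbs_move_cfg)
  let ?L = "l1 # l2 # ls"
  show "balls (early_state N a b c ?L N) \<in> permutations_of_set {1..n}"
    unfolding balls_early_state by (rule perm)
  have "c \<noteq> a" using perm by (auto simp: permutations_of_set_def)
  have 1: "carrier_run [] ([Some a, Some b] @ [] @ [Some c]) = ([e, f], [None, None, Some d])" and "e < f"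
    using assms(3,4) def \<open>c \<noteq> a\<close> by (auto split: if_splits)
  have 2: "carrier_run [e, f] (replicate (N * (N + 1)) None @ map Some ?L) =
      (?L, Some e # Some f # replicate (N * (N + 1) + N) None)"
    using carrier_run_exchange2[of l1 e l2 f ls "N * (N + 1)"] assms(1-6) \<open>e < f\<close> by simp
  have 3: "carrier_run ?L (replicate (N + 2) None) = ([], map Some ?L)"
    using carrier_run_unload[of ?L 0] L by simp
  show "carrier_run [] (early_state N a b c ?L N @ replicate (N + 2) None) = ([], late_state N d e f ?L 0)"
    apply (rule carrier_run_cong[OF carrier_run_appendI[OF carrier_run_empty[of "2 * N + 2"]
        carrier_run_appendI[OF 1 carrier_run_appendI[OF 2 3]]]])
    subgoal by (simp add: early_state_def)
    by (simp add: early_state_def late_state_def replicate_merge algebra_simps del: replicate_Suc)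
qed

text \<open>The gaps grow by the speed differences 1 and \<open>N\<close>. The label inequalities
  cover closed gaps, where balls are bumped instead of dropped: the first gap at
  \<open>s = 0\<close>, and the second one for \<open>N = 0\<close>, when the pair and
  \<open>L\<close> travel side by side at equal speed.\<close>

lemma move_late_state:
  assumes L: "sorted_wrt (<) (l1 # l2 # ls)" "length ls = N" and "e < d" "e < f" "l1 < e" "l2 < f"
    and perm: "[d, e, f] @ l1 # l2 # ls \<in> permutations_of_set {1..n}"
  shows "bbs_move n (cfg (late_state N d e f (l1 # l2 # ls) s)) =
    cfg (late_state N d e f (l1 # l2 # ls) (Suc s))"
proof (rule bbs_move_cfg)
  let ?L = "l1 # l2 # ls"
  show "balls (late_state N d e f ?L s) \<in> permutations_of_set {1..n}"
    unfolding balls_late_state by (rule perm)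
  have 1: "carrier_run [] [Some d] = ([d], [None])" by simp
  have 2: "carrier_run [e, f] (replicate (N * (N + 2 + s)) None @ map Some ?L) =
      (?L, Some e # Some f # replicate (N * (N + 2 + s) + N) None)"
    using carrier_run_exchange2[of l1 e l2 f ls "N * (N + 2 + s)"] assms(1-6) by simp
  have 3: "carrier_run ?L (replicate (N + 2) None) = ([], map Some ?L)"
    using carrier_run_unload[of ?L 0] L by simp
  show "carrier_run [] (late_state N d e f ?L s @ replicate (N + 2) None) = ([], late_state N d e f ?L (Suc s))"
    apply (rule carrier_run_cong[OF carrier_run_appendI[OF carrier_run_empty[of "2 * N + 4 + s"]
        carrier_run_appendI[OF 1 carrier_run_appendI[OF carrier_run_single[of e d f s]
          carrier_run_appendI[OF 2 3]]]]])
    using assms(3,4) apply simp_all[2]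
    subgoal by (simp add: late_state_def)
    apply (simp only: late_state_def append.simps replicate_merge mult_Suc add_Suc_right)
    by (simp add: algebra_simps del: replicate_Suc)
qed

section \<open>Runs and the steady state\<close>

text \<open>Exposes the position that \<open>increasing_run\<close> quantifies away, so that
  overlapping runs can be compared.\<close>

definition run_at :: "config \<Rightarrow> nat list \<Rightarrow> nat \<Rightarrow> bool" where
  "run_at c r i \<longleftrightarrow> r \<noteq> [] \<and> sorted_wrt (<) r \<and>
     (\<forall>k < length r. c (i + k) = Some (r ! k)) \<and>
     (\<forall>b. i > 0 \<and> c (i - 1) = Some b \<longrightarrow> \<not> b < hd r) \<and>
     (\<forall>b. c (i + length r) = Some b \<longrightarrow> \<not> last r < b)"

lemma increasing_run_iff: "increasing_run c r \<longleftrightarrow> (\<exists>i. run_at c r i)"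
  by (auto simp: increasing_run_def run_at_def)

text \<open>A run starting strictly inside \<open>r\<close> would have a smaller ball of
  \<open>r\<close> right before it, against its maximality to the left.\<close>

lemma run_at_start_unique:
  assumes "run_at c r i" "run_at c r' j" "j < i + length r"
  shows "j \<le> i"
proof (rule ccontr)
  assume "\<not> j \<le> i"
  define k where "k = j - i - 1"
  have k: "j = i + Suc k" "Suc k < length r" using \<open>\<not> j \<le> i\<close> assms(3) by (auto simp: k_def)
  have "r' \<noteq> []" "c (j + 0) = Some (r' ! 0)" "c (i + Suc k) = Some (r ! Suc k)" "c (i + k) = Some (r ! k)"
    using assms(1,2) k by (auto simp: run_at_def simp del: add_Suc_right)
  moreover have "r ! k < r ! Suc k"
    using assms(1) k by (auto simp: run_at_def sorted_wrt_iff_nth_less)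
  ultimately show False using assms(2) k by (auto simp: run_at_def hd_conv_nth)
qed

text \<open>A longer run from the same box would extend \<open>r\<close>, against the maximality of
  \<open>r\<close> to the right.\<close>

lemma run_at_end_unique:
  assumes "run_at c r i" "run_at c r' i"
  shows "length r' \<le> length r"
proof (rule ccontr)
  assume "\<not> length r' \<le> length r"
  then obtain m where m: "length r = Suc m" "Suc m < length r'"
    using assms(1) by (cases r) (auto simp: run_at_def)
  have "r \<noteq> []" "c (i + m) = Some (r ! m)" "c (i + m) = Some (r' ! m)" "c (i + Suc m) = Some (r' ! Suc m)"
    using assms m by (auto simp: run_at_def simp del: add_Suc_right)
  moreover have "r' ! m < r' ! Suc m"
    using assms(2) m by (auto simp: run_at_def sorted_wrt_iff_nth_less)
  ultimately show False using assms(1) m by (auto simp: run_at_def last_conv_nth)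
qed

lemma run_at_overlap:
  assumes "run_at c r i" "run_at c r' j" "i \<le> x" "x < i + length r" "j \<le> x" "x < j + length r'"
  shows "r = r'"
proof -
  have "i = j"
    using run_at_start_unique[OF assms(1,2)] run_at_start_unique[OF assms(2,1)] assms by simp
  then have "length r = length r'"
    using run_at_end_unique[of c r i r'] run_at_end_unique[of c r' i r] assms by simp
  then show ?thesis using assms(1,2) \<open>i = j\<close> by (intro nth_equalityI) (auto simp: run_at_def)
qed

lemma run_at_cfg:
  assumes "xs = us @ map Some r @ vs" "i = length us" "r \<noteq> []" "sorted_wrt (<) r"
    and "\<And>b. us \<noteq> [] \<Longrightarrow> last us = Some b \<Longrightarrow> hd r \<le> b"
    and "\<And>b. vs \<noteq> [] \<Longrightarrow> hd vs = Some b \<Longrightarrow> b \<le> last r"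
  shows "run_at (cfg xs) r i"
proof -
  have "hd r \<le> b" if "i > 0" "cfg xs (i - 1) = Some b" for b
  proof -
    have "us \<noteq> []" using that assms(2) by auto
    then have "last us = Some b"
      using that assms(1,2) by (cases us rule: rev_cases) (auto simp: cfg_def nth_append)
    then show ?thesis using assms(5) \<open>us \<noteq> []\<close> by blast
  qed
  moreover have "b \<le> last r" if "cfg xs (i + length r) = Some b" for b
  proof -
    have "vs \<noteq> []" using that assms(1,2) by (auto simp: cfg_def split: if_splits)
    then have "hd vs = Some b"
      using that assms(1,2) by (simp add: cfg_def nth_append hd_conv_nth)
    then show ?thesis using assms(6) \<open>vs \<noteq> []\<close> by blast
  qed
  moreover have "cfg xs (i + k) = Some (r ! k)" if "k < length r" for k
    using that assms(1,2) by (simp add: cfg_def nth_append)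
  ultimately show ?thesis using assms(3,4) by (auto simp: run_at_def not_less)
qed

lemma box_of_cfg:
  assumes "distinct (balls xs)" "cfg xs i = Some b"
  shows "box_of (cfg xs) b = i"
  unfolding box_of_def using assms(2) cfg_unique[OF assms(1) _ assms(2)] by (rule the_equality)

text \<open>When the gap is closed, the descent from \<open>b\<close> to \<open>c\<close> still ends
  the run. Its presence is what later rules out an earlier steady state.\<close>

lemma early_state_run:
  assumes "a < b" "c < b"
  shows "increasing_run (cfg (early_state N a b c L s)) [a, b]"
  unfolding increasing_run_iff
proof (rule exI, rule run_at_cfg)
  let ?vs = "replicate (N - s) None @ [Some c] @ replicate (s * (N + 1)) None @ map Some L"
  show "early_state N a b c L s = replicate (2 * s + 2) None @ map Some [a, b] @ ?vs"
    by (simp add: early_state_def)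
  show "x \<le> last [a, b]" if "hd ?vs = Some x" for x
    using that assms by (cases "N - s") auto
qed (use assms in \<open>auto simp: last_replicate split: if_splits\<close>)

text \<open>The inequalities put a descent at every block boundary, so the three blocks are separate
  runs even when no empty box lies between them.\<close>

locale separated_solitons =
  fixes N d e f l1 l2 :: nat and ls :: "nat list" and n :: nat
  assumes sorted: "sorted_wrt (<) (l1 # l2 # ls)" and len: "length ls = N"
    and ed: "e < d" and ef: "e < f" and l1e: "l1 < e" and l2f: "l2 < f"
    and perm: "[d, e, f] @ l1 # l2 # ls \<in> permutations_of_set {1..n}"
begin

abbreviation "blocks \<equiv> late_state N d e f (l1 # l2 # ls)"

lemma runs_at:
  "run_at (cfg (blocks s)) [d] (2 * N + 4 + s)"
  "run_at (cfg (blocks s)) [e, f] (2 * N + 5 + 2 * s)"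
  "run_at (cfg (blocks s)) (l1 # l2 # ls) (2 * N + 7 + 2 * s + N * (N + 2 + s))"
proof -
  let ?u1 = "replicate (2 * N + 4 + s) None" and ?g = "replicate (N * (N + 2 + s)) None"
  let ?L = "l1 # l2 # ls"
  let ?v1 = "replicate s None @ [Some e, Some f] @ ?g @ map Some ?L"
  let ?u2 = "?u1 @ [Some d] @ replicate s None" and ?v2 = "?g @ map Some ?L"
  let ?u3 = "?u2 @ [Some e, Some f] @ ?g"
  show "run_at (cfg (blocks s)) [d] (2 * N + 4 + s)"
  proof (rule run_at_cfg)
    show "blocks s = ?u1 @ map Some [d] @ ?v1" by (simp add: late_state_def)
    show "x \<le> last [d]" if "hd ?v1 = Some x" for x
      using that ed by (cases s) auto
  qed (auto simp: last_replicate split: if_splits)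
  show "run_at (cfg (blocks s)) [e, f] (2 * N + 5 + 2 * s)"
  proof (rule run_at_cfg)
    show "blocks s = ?u2 @ map Some [e, f] @ ?v2" by (simp add: late_state_def)
    show "hd [e, f] \<le> x" if "last ?u2 = Some x" for x
      using that ed by (cases s) (auto simp: last_replicate split: if_splits)
    show "x \<le> last [e, f]" if "hd ?v2 = Some x" for x
      using that l1e ef by (cases "N * (N + 2 + s)") auto
  qed (use ef in auto)
  show "run_at (cfg (blocks s)) ?L (2 * N + 7 + 2 * s + N * (N + 2 + s))"
  proof (rule run_at_cfg)
    show "blocks s = ?u3 @ map Some ?L @ []" by (simp add: late_state_def)
    show "hd ?L \<le> x" if "last ?u3 = Some x" for x
      using that l1e ef by (cases "N * (N + 2 + s)") (auto simp: last_replicate split: if_splits)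
  qed (use sorted in auto)
qed

text \<open>The first ball of a run lies in one of the three blocks; sharing a box with that block,
  the run coincides with it.\<close>

lemma increasing_run_blocks:
  "increasing_run (cfg (blocks s)) r \<longleftrightarrow> r \<in> {[d], [e, f], l1 # l2 # ls}"
proof
  assume "increasing_run (cfg (blocks s)) r"
  then obtain i where i: "run_at (cfg (blocks s)) r i" by (auto simp: increasing_run_iff)
  then have r: "r \<noteq> []" and "cfg (blocks s) (i + 0) = Some (r ! 0)" unfolding run_at_def by blast+
  then have "i = 2 * N + 4 + s \<or> (2 * N + 5 + 2 * s \<le> i \<and> i < 2 * N + 5 + 2 * s + 2) \<or>
      (2 * N + 7 + 2 * s + N * (N + 2 + s) \<le> i \<and> i < 2 * N + 7 + 2 * s + N * (N + 2 + s) + (N + 2))"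
    using len by (auto simp: cfg_def late_state_def nth_append nth_Cons' split: if_splits)
  then show "r \<in> {[d], [e, f], l1 # l2 # ls}"
    using run_at_overlap[OF i runs_at(1)[of s], of i] run_at_overlap[OF i runs_at(2)[of s], of i]
      run_at_overlap[OF i runs_at(3)[of s], of i] r len by auto
qed (auto simp: increasing_run_iff intro: runs_at)

lemma distinct_blocks: "distinct (balls (blocks s))"
  unfolding balls_late_state using perm by (rule permutations_of_setD)

lemma box_of_blocks:
  "box_of (cfg (blocks s)) d = 2 * N + 4 + s"
  "box_of (cfg (blocks s)) e = 2 * N + 5 + 2 * s"
  "box_of (cfg (blocks s)) l1 = 2 * N + 7 + 2 * s + N * (N + 2 + s)"
  by (rule box_of_cfg[OF distinct_blocks]; use runs_at[of s] in \<open>force simp: run_at_def\<close>)+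

lemma bbs_move_blocks: "(bbs_move n ^^ t) (cfg (blocks s)) = cfg (blocks (s + t))"
  by (induction t) (simp_all only: add_0_right funpow.simps o_apply id_apply add_Suc_right
      move_late_state[OF sorted len ed ef l1e l2f perm])

text \<open>A move only increases \<open>s\<close>, while neither the set of runs nor the order of
  their first boxes depends on \<open>s\<close>.\<close>

lemma steady_state_blocks: "steady_state n (cfg (blocks s))"
  unfolding steady_state_def soliton_def Let_def bbs_move_blocks increasing_run_blocks
  by (auto simp: box_of_blocks)

end

section \<open>Words with the prescribed recording tableau\<close>

lemma row_insert_mset: "row_insert x r = (r', Some y) \<Longrightarrow> add_mset y (mset r') = add_mset x (mset r)"
  by (induction r arbitrary: r') (auto split: prod.splits if_splits)

lemma row_insert_sorted:
  "row_insert x r = (r', y) \<Longrightarrow> sorted_wrt (<) r \<Longrightarrow> x \<notin> set r \<Longrightarrow> sorted_wrt (<) r'"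
proof (induction r arbitrary: r')
  case (Cons z r)
  show ?case
  proof (cases "x < z")
    case False
    obtain r'' where r'': "row_insert x r = (r'', y)" "r' = z # r''"
      using Cons.prems(1) False by (auto split: prod.splits)
    have "set r'' \<subseteq> insert x (set r)" using row_insert_set[of x r] r'' by simp
    then show ?thesis using Cons.IH[OF r''(1)] Cons.prems r'' False by auto
  qed (use Cons.prems in \<open>force intro: less_trans\<close>)
qed simp

section \<open>Reading the insertion steps off the recording tableau\<close>

definition insertion_tableau :: "nat list \<Rightarrow> tableau" where
  "insertion_tableau w = fst (robinson_schensted w)"

lemma robinson_schensted_snoc:
  "robinson_schensted (w @ [x]) = rs_step (Suc (length w), x) (robinson_schensted w)"
proof -
  have "[1..<length (w @ [x]) + 1] = [1..<length w + 1] @ [Suc (length w)]" by simp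
  then show ?thesis by (simp add: robinson_schensted_def del: upt_Suc)
qed

lemma insertion_tableau_Nil: "insertion_tableau [] = []"
  by (simp add: insertion_tableau_def robinson_schensted_def)

lemma insertion_tableau_snoc: "insertion_tableau (w @ [x]) = rs_insert x (insertion_tableau w)"
  by (simp add: insertion_tableau_def robinson_schensted_snoc rs_step_def split: prod.splits)

lemma recording_tableau_snoc:
  "recording_tableau (w @ [x]) =
    add_cell (Suc (length w)) (new_cell_row x (insertion_tableau w)) (recording_tableau w)"
  by (simp add: insertion_tableau_def recording_tableau_def robinson_schensted_snoc rs_step_def
      split: prod.splits)

lemma new_cell_row_le: "new_cell_row x P \<le> length P"
  by (induction P arbitrary: x) (auto split: prod.splits option.splits)

lemma length_rs_insert:
  "length (rs_insert x P) = (if new_cell_row x P = length P then Suc (length P) else length P)"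
  by (induction P arbitrary: x) (auto split: prod.splits option.splits)

lemma length_add_cell:
  "i \<le> length Q \<Longrightarrow> length (add_cell k i Q) = (if i = length Q then Suc (length Q) else length Q)"
  by (induction k i Q rule: add_cell.induct) auto

lemma length_recording_tableau: "length (recording_tableau w) = length (insertion_tableau w)"
proof (induction w rule: rev_induct)
  case (snoc x w)
  then show ?case
    using new_cell_row_le[of x "insertion_tableau w"]
    by (simp add: recording_tableau_snoc insertion_tableau_snoc length_rs_insert length_add_cell)
qed (simp add: recording_tableau_def insertion_tableau_def robinson_schensted_def)

lemma add_cell_old:
  "j < length Q \<Longrightarrow> m \<in> set (Q ! j) \<Longrightarrow> j < length (add_cell k i Q) \<and> m \<in> set (add_cell k i Q ! j)"
proof (induction k i Q arbitrary: j rule: add_cell.induct)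
  case (1 k r rs)
  then show ?case by (cases j) auto
next
  case (2 k i r rs)
  then show ?case by (cases j) auto
qed auto

lemma add_cell_new:
  "i \<le> length Q \<Longrightarrow> i < length (add_cell k i Q) \<and> k \<in> set (add_cell k i Q ! i)"
  by (induction k i Q rule: add_cell.induct) auto

text \<open>Cells of the recording tableau never move, so the final tableau still shows which row
  grew at each step. The letter at index \<open>k\<close> has the entry
  \<open>Suc k\<close>.\<close>

lemma recording_tableau_entry:
  assumes "k < length w" "r = new_cell_row (w ! k) (insertion_tableau (take k w))"
  shows "r < length (recording_tableau w) \<and> Suc k \<in> set (recording_tableau w ! r)"
  using assms
proof (induction w rule: rev_induct)
  case (snoc x w)
  show ?case
  proof (cases "k < length w")
    case True
    then have "r < length (recording_tableau w)" "Suc k \<in> set (recording_tableau w ! r)"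
      using snoc by (simp_all add: nth_append)
    then show ?thesis unfolding recording_tableau_snoc by (rule add_cell_old)
  next
    case False
    then have "k = length w" using snoc.prems by simp
    then have "r = new_cell_row x (insertion_tableau w)" using snoc.prems by simp
    then show ?thesis using \<open>k = length w\<close> add_cell_new new_cell_row_le
      by (simp add: recording_tableau_snoc length_recording_tableau)
  qed
qed simp

lemma new_cell_row_Q_hat:
  assumes "recording_tableau w = Q_hat n" "5 \<le> n" "k < length w" "length w = n"
  shows "new_cell_row (w ! k) (insertion_tableau (take k w)) =
    (if k = 2 \<or> k = 3 then 1 else if Suc k = n then 2 else 0)"
proof -
  define r where "r = new_cell_row (w ! k) (insertion_tableau (take k w))"
  have "r < 3" "Suc k \<in> set (Q_hat n ! r)"
    using recording_tableau_entry[OF assms(3) r_def] assms(1) by (auto simp: Q_hat_def)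
  moreover from this have "r = 0 \<or> r = 1 \<or> r = 2" by linarith
  ultimately show ?thesis using assms(2-4) unfolding r_def[symmetric] by (auto simp: Q_hat_def)
qed

text \<open>The insertion is replayed: entries 1, 2 give \<open>a < b\<close>; 3, 4 make
  \<open>r1\<close> and \<open>r2\<close> bump \<open>a\<close> and \<open>b\<close>; 5 to
  \<open>n - 1\<close> append to the first row; \<open>n\<close> makes \<open>x\<close> bump
  \<open>c\<close>, which bumps again in the row \<open>[a, b]\<close>.\<close>

lemma Q_hat_word:
  assumes Q: "recording_tableau w = Q_hat n" and n: "n = N + 5"
    and w: "w \<in> permutations_of_set {1..n}"
  obtains a b r1 r2 rs x L c where "w = a # b # (r1 # r2 # rs) @ [x]" "length rs = N"
    "sorted_wrt (<) (r1 # r2 # rs)" "r1 < a" "a < b" "r2 < b"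
    "row_insert x (r1 # r2 # rs) = (L, Some c)" "c < b"
proof -
  have dist: "distinct w" and len: "length w = N + 5"
    using w n by (auto simp: permutations_of_set_def distinct_card[symmetric])
  obtain a b r1 r2 v where v: "w = a # b # r1 # r2 # v" "length v = Suc N"
    using len by (auto simp: numeral_eq_Suc length_Suc_conv)
  obtain rs x where rs: "v = rs @ [x]" "length rs = N"
    using v(2) by (cases v rule: rev_cases) auto
  have row: "new_cell_row (w ! k) (insertion_tableau (take k w)) =
      (if k = 2 \<or> k = 3 then 1 else if k = N + 4 then 2 else 0)" if "k < N + 5" for k
    using new_cell_row_Q_hat[OF Q, of k] that len n by simp
  have T: "insertion_tableau [y] = [[y]]" for y
    using insertion_tableau_snoc[of "[]" y] by (simp add: insertion_tableau_Nil)
  have "new_cell_row b (insertion_tableau [a]) = 0" using row[of 1] by (simp add: v)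
  moreover have "b \<noteq> a" "r1 \<noteq> a" "r1 \<noteq> r2" using dist by (auto simp: v)
  ultimately have ab: "a < b" by (auto simp: T split: if_splits)
  have T2: "insertion_tableau [a, b] = [[a, b]]"
    using insertion_tableau_snoc[of "[a]" b] ab T by simp
  have T3: "insertion_tableau [a, b, r1] = rs_insert r1 [[a, b]]"
    using insertion_tableau_snoc[of "[a, b]" r1] T2 by simp
  have T4: "insertion_tableau [a, b, r1, r2] = rs_insert r2 (rs_insert r1 [[a, b]])"
    using insertion_tableau_snoc[of "[a, b, r1]" r2] T3 by simp
  have row2: "new_cell_row r1 [[a, b]] = 1"
    using row[of 2] by (simp add: v T2 numeral_2_eq_2)
  have row3: "new_cell_row r2 (rs_insert r1 [[a, b]]) = 1"
    using row[of 3] by (simp add: v T3 numeral_3_eq_3)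
  \<comment> \<open>If \<open>r1\<close> bumped \<open>b\<close> instead of \<open>a\<close>,
    whatever \<open>r2\<close> bumps would be below \<open>b\<close> and open a third row. Likewise
    \<open>r2 < r1\<close> would bump \<open>r1\<close>, which is below \<open>a\<close>.\<close>
  have order: "r1 < a" "r1 < r2" "r2 < b"
    using row2 row3 ab \<open>r1 \<noteq> a\<close> \<open>r1 \<noteq> r2\<close> by (auto split: if_splits)
  then have T4': "insertion_tableau [a, b, r1, r2] = [[r1, r2], [a, b]]"
    using T4 ab by simp
  have R: "insertion_tableau (a # b # r1 # r2 # take j rs) = [r1 # r2 # take j rs, [a, b]] \<and>
      sorted_wrt (<) (r1 # r2 # take j rs)" if "j \<le> N" for j
    using that
  proof (induction j)
    case 0
    then show ?case using T4' order by simp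
  next
    case (Suc j)
    let ?y = "rs ! j" and ?R = "r1 # r2 # take j rs"
    have t: "take (Suc j) rs = take j rs @ [?y]" using Suc.prems rs by (simp add: take_Suc_conv_app_nth)
    have "new_cell_row ?y [?R, [a, b]] = 0"
      using row[of "j + 4"] Suc by (simp add: v rs nth_append numeral_eq_Suc)
    then obtain r' where r': "row_insert ?y ?R = (r', None)"
      by (cases "row_insert ?y ?R"; cases "snd (row_insert ?y ?R)") auto
    have "r' = ?R @ [?y]" "\<forall>z\<in>set ?R. z \<le> ?y" using row_insert_None[OF r'] by auto
    \<comment> \<open>Distinctness turns the weak inequalities from row insertion into strict
      ones.\<close>
    moreover have "?y \<notin> set ?R"
    proof -
      have "distinct (r1 # r2 # rs)" using dist by (simp add: v rs)
      then have "distinct (take (Suc (Suc (Suc j))) (r1 # r2 # rs))" by (rule distinct_take)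
      then show ?thesis by (simp add: t)
    qed
    ultimately have "\<forall>z\<in>set ?R. z < ?y" by (metis le_neq_implies_less)
    moreover have "insertion_tableau (a # b # r1 # r2 # take (Suc j) rs) =
        rs_insert ?y (insertion_tableau (a # b # ?R))"
      using insertion_tableau_snoc[of "a # b # ?R" ?y] t by simp
    ultimately show ?case
      using Suc r' \<open>r' = ?R @ [?y]\<close> t by (simp del: row_insert.simps add: sorted_wrt_append)
  qed
  let ?R = "r1 # r2 # rs"
  have TR: "insertion_tableau (a # b # ?R) = [?R, [a, b]]" "sorted_wrt (<) ?R"
    using R[of N] rs by auto
  have "new_cell_row x [?R, [a, b]] = 2"
    using row[of "N + 4"] by (simp add: v rs TR nth_append numeral_eq_Suc)
  then obtain L c where L: "row_insert x ?R = (L, Some c)" and "new_cell_row c [[a, b]] = 1"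
    by (cases "row_insert x ?R"; cases "snd (row_insert x ?R)") (auto simp del: row_insert.simps)
  then have "c < b" using ab by (auto split: if_splits)
  show ?thesis
    using that[of a b r1 r2 rs x L c] v rs TR order ab L \<open>c < b\<close> by simp
qed

text \<open>The carrier repeats the first-row insertions: \<open>r1\<close> and \<open>r2\<close>
  push out \<open>a\<close> and \<open>b\<close>, the \<open>N\<close> balls of \<open>rs\<close>
  are loaded and leave the gap, and \<open>x\<close> pushes out \<open>c\<close>. Then
  \<open>L\<close> is unloaded.\<close>

lemma first_move:
  assumes "sorted_wrt (<) (r1 # r2 # rs)" "length rs = N" "r1 < a" "a < b" "r2 < b"
    and ins: "row_insert x (r1 # r2 # rs) = (L, Some c)"
    and sorted: "sorted_wrt (<) L" and len: "length L = N + 2"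
    and perm: "a # b # (r1 # r2 # rs) @ [x] \<in> permutations_of_set {1..n}"
  shows "bbs_move n (cfg (map Some (a # b # (r1 # r2 # rs) @ [x]))) = cfg (early_state N a b c L 0)"
proof (rule bbs_move_cfg)
  let ?R = "r1 # r2 # rs"
  show "balls (map Some (a # b # ?R @ [x])) \<in> permutations_of_set {1..n}"
    unfolding balls_simps by (rule perm)
  have 1: "carrier_run [] [Some a, Some b] = ([a, b], [None, None])" using assms(4) by simp
  have 2: "carrier_run [a, b] (map Some ?R) = (?R, Some a # Some b # replicate N None)"
    using carrier_run_exchange2[OF assms(3,5,4,1), of 0] assms(2) by simp
  have 3: "carrier_run ?R [Some x] = (L, [Some c])"
    using ins by (simp del: row_insert.simps)
  have 4: "carrier_run L (replicate (N + 2) None) = ([], map Some L)"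
    using carrier_run_unload[of L 0] len by simp
  show "carrier_run [] (map Some (a # b # ?R @ [x]) @ replicate (N + 2) None) =
    ([], early_state N a b c L 0)"
    by (rule carrier_run_cong[OF carrier_run_appendI[OF 1 carrier_run_appendI[OF 2
        carrier_run_appendI[OF 3 4]]]]) (simp_all add: early_state_def numeral_2_eq_2)
qed

text \<open>By the place where \<open>x\<close> lands. The final disjunction serves the collision:
  the larger ball \<open>f\<close> of the new pair is \<open>b\<close> if \<open>c < a\<close> and
  \<open>c\<close> otherwise, and \<open>l2\<close> must lie below it.\<close>

lemma row_insert_two_smallest:
  assumes ins: "row_insert x (r1 # r2 # rs) = (L, Some c)"
    and sorted: "sorted_wrt (<) (r1 # r2 # rs)" and "x \<notin> set (r1 # r2 # rs)"
    and "r1 < a" "r2 < b"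
  obtains l1 l2 ls where "L = l1 # l2 # ls" "l1 < a" "l2 < b" "l1 < c" "c < a \<or> l2 < c"
proof -
  consider "x < r1" | "r1 < x" "x < r2" | "r2 < x" using assms(3) by fastforce
  then show ?thesis
  proof cases
    case 1
    then show ?thesis using that[of x r2 rs] assms by auto
  next
    case 2
    then show ?thesis using that[of r1 x rs] assms by auto
  next
    case 3
    then obtain rs' where "row_insert x rs = (rs', Some c)" "L = r1 # r2 # rs'"
      using ins sorted by (auto split: prod.splits)
    then show ?thesis using that[of r1 r2 rs'] row_insert_bumped_in assms by fastforce
  qed
qed

theorem theorem6p7:
  fixes n :: nat and w :: "nat list"
  assumes "n \<ge> 5"
    and "w \<in> permutations_of_set {1..n}"
    and "recording_tableau w = Q_hat n"
  shows "steady_state_time w = n - 3"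
proof -
  obtain N where n: "n = N + 5" using assms(1) by (metis le_add_diff_inverse2)
  obtain a b r1 r2 rs x L c where w: "w = a # b # (r1 # r2 # rs) @ [x]" and rs: "length rs = N"
    "sorted_wrt (<) (r1 # r2 # rs)" and order: "r1 < a" "a < b" "r2 < b"
    and ins: "row_insert x (r1 # r2 # rs) = (L, Some c)" and "c < b"
    using Q_hat_word[OF assms(3) n assms(2)] by metis
  have dist: "distinct w" and set: "set w = {1..n}" using assms(2) by (auto simp: permutations_of_set_def)
  have x: "x \<notin> set (r1 # r2 # rs)" using dist w by auto
  obtain l1 l2 ls where L: "L = l1 # l2 # ls" and l: "l1 < a" "l2 < b" "l1 < c" "c < a \<or> l2 < c"
    using row_insert_two_smallest[OF ins rs(2) x order(1,3)] by blast
  have sortedL: "sorted_wrt (<) (l1 # l2 # ls)" using row_insert_sorted[OF ins rs(2) x] L by simp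
  have m: "mset ([a, b, c] @ L) = mset w" using row_insert_mset[OF ins] w by simp
  have perm_abc: "[a, b, c] @ l1 # l2 # ls \<in> permutations_of_set {1..n}"
    using mset_eq_setD[OF m] mset_eq_imp_distinct_iff[OF m] dist set L
    by (intro permutations_of_setI) auto
  have lenL: "length ls = N" using mset_eq_length[OF m] w L rs by simp
  have len_w: "length w = n" using w rs n by simp
  \<comment> \<open>The outcome of row-inserting \<open>c\<close> into \<open>[a, b]\<close>, as in
    \<open>collide_early_state\<close>.\<close>
  define d e f where "d = (if c < a then a else b)" and "e = (if c < a then c else a)"
    and "f = (if c < a then b else c)"
  have "c \<noteq> a" using perm_abc by (auto simp: permutations_of_set_def)
  have perm': "[d, e, f] @ l1 # l2 # ls \<in> permutations_of_set {1..n}"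
    using perm_abc by (auto simp: permutations_of_set_def d_def e_def f_def)
  interpret separated_solitons N d e f l1 l2 ls n
    using sortedL lenL l order \<open>c < b\<close> \<open>c \<noteq> a\<close> perm'
    by unfold_locales (auto simp: d_def e_def f_def)
  have init: "bbs_state w 0 = cfg (map Some w)"
    by (auto simp: bbs_state_def initial_config_def cfg_def)
  have Suc_state: "bbs_state w (Suc t) = bbs_move n (bbs_state w t)" for t
    by (simp add: bbs_state_def len_w)
  have early: "bbs_state w (Suc s) = cfg (early_state N a b c L s)" if "s \<le> N" for s
    using that
  proof (induction s)
    case 0
    have "sorted_wrt (<) L" "length L = N + 2" using sortedL L lenL by auto
    then show ?case
      unfolding Suc_state init
      using first_move[OF rs(2,1) order(1,2,3) ins _ _ assms(2)[unfolded w]] unfolding w by blast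
  next
    case (Suc s)
    have "s < N" "sorted_wrt (<) L" "length L = N + 2" "hd L < c"
      using Suc.prems sortedL L lenL l by auto
    then show ?case
      unfolding Suc_state[of "Suc s"]
      using move_early_state[of s N L c a b n] Suc order \<open>c < b\<close> perm_abc[folded L] by (metis Suc_leD)
  qed
  have late: "bbs_state w (N + 2) = cfg (blocks 0)"
  proof -
    have "bbs_move n (cfg (early_state N a b c L N)) = cfg (blocks 0)"
      unfolding L
      by (rule collide_early_state[OF sortedL lenL order(2) \<open>c < b\<close> l1e l2f _ perm_abc])
        (simp add: d_def e_def f_def)
    then show ?thesis using Suc_state[of "Suc N"] early[of N] by simp
  qed
  \<comment> \<open>The pair is a run at time 0 because \<open>r1 < a\<close>, and afterwards in
    every early state.\<close>
  have run: "increasing_run (bbs_state w t) [a, b]" if "t < N + 2" for t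
  proof (cases t)
    case 0
    have "run_at (cfg (map Some w)) [a, b] 0"
      by (rule run_at_cfg[of _ "[]" _ "map Some ((r1 # r2 # rs) @ [x])"]) (use w order in auto)
    then show ?thesis using 0 init by (auto simp: increasing_run_iff)
  next
    case (Suc s)
    then show ?thesis using that early[of s] early_state_run[OF order(2) \<open>c < b\<close>] by simp
  qed
  \<comment> \<open>A steady state would keep \<open>[a, b]\<close> as a run up to time
    \<open>N + 2\<close>. There the pair is \<open>[c, b]\<close> or \<open>[a, c]\<close>, and
    \<open>L\<close> starts with \<open>l1 < a\<close>.\<close>
  have "\<not> steady_state n (bbs_state w t)" if "t < N + 2" for t
  proof
    assume "steady_state n (bbs_state w t)"
    then have "increasing_run ((bbs_move n ^^ (N + 2 - t)) (bbs_state w t)) [a, b]"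
      using run[OF that] by (auto simp: steady_state_def soliton_def Let_def)
    moreover have "(bbs_move n ^^ (N + 2 - t)) (bbs_state w t) = bbs_state w (N + 2)"
      using fun_cong[OF funpow_add[of "N + 2 - t" t "bbs_move n"], of "initial_config w"] that
      by (simp add: bbs_state_def len_w)
    ultimately have "[a, b] \<in> {[d], [e, f], l1 # l2 # ls}"
      using increasing_run_blocks late by simp
    then show False using \<open>c \<noteq> a\<close> \<open>c < b\<close> l(1) by (auto simp: e_def f_def split: if_splits)
  qed
  moreover have "steady_state n (bbs_state w (N + 2))"
    using steady_state_blocks late by simp
  ultimately have "steady_state_time w = N + 2"
    unfolding steady_state_time_def len_w by (intro Least_equality) (auto simp: not_less[symmetric])
  then show ?thesis using n by simp
qed

end
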